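(* For every odd integer $n \ge 17$ with $n \ne 27$, there exists an $n$-vertex graph without induced $5$-cycles which is $\frac{n-1}{2}$-regular if $n \equiv 1 \pmod 4$, and almost $\frac{n-1}{2}$-regular if $n \equiv 3 \pmod 4$. For $n = 27$, there exists a $27$-vertex graph without induced $5$-cycles in which the total number of triangles and anti-triangles equals $M(27)+1 = 645$.
   Context: A graph is $d$-regular if every vertex has degree $d$. A graph is almost $d$-regular if all vertices except one have degree $d$ and the remaining vertex has degree $d+1$ or $d-1$. A triangle is a set of three pairwise adjacent vertices; an anti-triangle is a set of three pairwise non-adjacent vertices. For $n=2m+1$ with $m$ odd, $M(n) = \frac{1}{6}(2m-3)(m-1)(m+1)$; in particular $M(27)=644$. *)

theory Defs
  imports Complex_Main "Graph_Theory.Graph_Theory"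
begin

text \<open>
  A finite simple undirected graph is a \<open>pair_graph\<close>: every edge \<open>{u, v}\<close> is represented by the
  two arcs \<open>(u, v)\<close> and \<open>(v, u)\<close>, so the degree of a vertex is its out-degree.
\<close>

definition degree :: "'a pair_pre_digraph \<Rightarrow> 'a \<Rightarrow> nat" where
  "degree G v = out_degree (with_proj G) v"

definition regular :: "nat \<Rightarrow> 'a pair_pre_digraph \<Rightarrow> bool" where
  "regular d G \<longleftrightarrow> (\<forall>v \<in> pverts G. degree G v = d)"

text \<open>
  The degree \<open>d - 1\<close> is expressed as \<open>degree G v + 1 = d\<close> to avoid truncated subtraction.
\<close>

definition almost_regular :: "nat \<Rightarrow> 'a pair_pre_digraph \<Rightarrow> bool" where
  "almost_regular d G \<longleftrightarrow>
    (\<exists>v \<in> pverts G. (degree G v = d + 1 \<or> degree G v + 1 = d) \<and>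
      (\<forall>u \<in> pverts G - {v}. degree G u = d))"

text \<open>The cycle on \<open>{0, \<dots>, k - 1}\<close>; a simple graph only for \<open>k \<ge> 3\<close>.\<close>

definition cycle_graph :: "nat \<Rightarrow> nat pair_pre_digraph" where
  "cycle_graph k =
    \<lparr> pverts = {..<k},
      parcs = {(i, j). i < k \<and> j < k \<and> (j = Suc i mod k \<or> i = Suc j mod k)} \<rparr>"

definition has_induced_cycle :: "nat \<Rightarrow> 'a pair_pre_digraph \<Rightarrow> bool" where
  "has_induced_cycle k G \<longleftrightarrow>
    (\<exists>H. induced_subgraph H (with_proj G) \<and> digraph_iso H (with_proj (cycle_graph k)))"

definition triangles :: "'a pair_pre_digraph \<Rightarrow> 'a set set" where
  "triangles G =
    {T. T \<subseteq> pverts G \<and> card T = 3 \<and> (\<forall>u \<in> T. \<forall>v \<in> T. u \<noteq> v \<longrightarrow> (u, v) \<in> parcs G)}"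

definition anti_triangles :: "'a pair_pre_digraph \<Rightarrow> 'a set set" where
  "anti_triangles G =
    {T. T \<subseteq> pverts G \<and> card T = 3 \<and> (\<forall>u \<in> T. \<forall>v \<in> T. u \<noteq> v \<longrightarrow> (u, v) \<notin> parcs G)}"

text \<open>
  Meaningful only for \<open>n = 2 m + 1\<close> with \<open>m\<close> odd, where the value is a natural number. It is
  real-valued so that neither the subtractions nor the division by 6 are truncated.
\<close>

definition M :: "nat \<Rightarrow> real" where
  "M n = (let m = (real n - 1) / 2 in 1 / 6 * (2 * m - 3) * (m - 1) * (m + 1))"

lemma M_27: "M 27 = 644"
  by (simp add: M_def)

end

theory Submission
  imports Defs
begin

text \<open>
  The graphs are blow-ups of the \<open>3 \<times> 3\<close> rook graph. The rook graph is the line graph of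
  \<open>K\<^bsub>3,3\<^esub>\<close> and has no induced pentagon; since a pentagon has no nontrivial module, replacing
  each vertex by a bipartite or co-bipartite graph creates none. The nine class sizes and the
  degrees inside the classes are then chosen so that all degrees are (almost) balanced. Given such
  a choice, enlarge every class but the first by two vertices, where the four neighbours of the
  first class keep their inner co-degree and its four non-neighbours keep their inner degree. This
  raises every degree by 8 and the order by 16, so finitely many parameter tables, found by computer
  search, cover all orders but 27. For 27, Goodman's identity turns the number of triangles and
  anti-triangles into a sum over the degrees: 24 vertices have degree 13 and three have degree 14.
\<close>

section \<open>Induced pentagons\<close>

text \<open>The non-edges are listed along the cycle a, c, e, b, d, because the complement of a
  pentagon is again a pentagon.\<close>

definition pentagon :: "('a \<Rightarrow> 'a \<Rightarrow> bool) \<Rightarrow> 'a \<Rightarrow> 'a \<Rightarrow> 'a \<Rightarrow> 'a \<Rightarrow> 'a \<Rightarrow> bool" where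
  "pentagon E a b c d e \<longleftrightarrow> distinct [a, b, c, d, e] \<and>
     E a b \<and> E b c \<and> E c d \<and> E d e \<and> E e a \<and>
     \<not> E a c \<and> \<not> E c e \<and> \<not> E e b \<and> \<not> E b d \<and> \<not> E d a"

text \<open>The vertices 0 to 4 of the cycle are pulled back along the isomorphism. Since
  \<open>H\<close> is induced, non-adjacency is pulled back as well.\<close>

lemma has_induced_cycle_5_pentagon:
  fixes G :: "'a pair_pre_digraph"
  assumes "has_induced_cycle 5 G"
  shows "\<exists>a b c d e. {a, b, c, d, e} \<subseteq> pverts G \<and> pentagon (\<lambda>u v. (u, v) \<in> parcs G) a b c d e"
proof -
  obtain H f where H: "induced_subgraph H (with_proj G)"
    and f: "pre_digraph.digraph_isomorphism H f" and C: "with_proj (cycle_graph 5) = app_iso f H"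
    using assms by (auto simp: has_induced_cycle_def digraph_iso_def)
  have ends: "tail H = fst" "head H = snd" and sub: "verts H \<subseteq> pverts G"
    and arcs: "arcs H = {x \<in> parcs G. fst x \<in> verts H \<and> snd x \<in> verts H}"
    using H by (auto simp: induced_subgraph_def subgraph_def compatible_def)
  have iv: "iso_verts f ` verts H = {..<5}"
    and ia: "iso_arcs f ` arcs H = parcs (cycle_graph 5)"
    and it: "iso_tail f = fst" "iso_head f = snd"
    using arg_cong[OF C, of verts] arg_cong[OF C, of arcs]
      arg_cong[OF C, of tail] arg_cong[OF C, of head] by (auto simp: cycle_graph_def)
  have inj: "inj_on (iso_verts f) (verts H)"
    using f by (simp add: pre_digraph.digraph_isomorphism_def)
  \<comment> \<open>An isomorphism maps arcs by a function of its own; as tail and head are the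
    projections on both sides, it acts on pairs componentwise.\<close>
  have arc: "iso_arcs f (u, v) = (iso_verts f u, iso_verts f v)" if "(u, v) \<in> arcs H" for u v
    using f that ends it by (auto simp: pre_digraph.digraph_isomorphism_def prod_eq_iff)
  have wf: "fst x \<in> verts H \<and> snd x \<in> verts H" if "x \<in> arcs H" for x
    using arcs that by simp
  have adj: "(u, v) \<in> parcs G \<longleftrightarrow> (iso_verts f u, iso_verts f v) \<in> parcs (cycle_graph 5)"
    if uv: "u \<in> verts H" "v \<in> verts H" for u v
  proof
    assume "(u, v) \<in> parcs G"
    then have "(u, v) \<in> arcs H" using uv arcs by simp
    then show "(iso_verts f u, iso_verts f v) \<in> parcs (cycle_graph 5)"
      using arc ia by (metis imageI)
  next
    assume "(iso_verts f u, iso_verts f v) \<in> parcs (cycle_graph 5)"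
    then obtain x y where xy: "(x, y) \<in> arcs H"
      "iso_arcs f (x, y) = (iso_verts f u, iso_verts f v)"
      unfolding ia[symmetric] by (metis imageE prod.collapse)
    then have "iso_verts f x = iso_verts f u" "iso_verts f y = iso_verts f v"
      using arc by auto
    then have "x = u" "y = v" using wf[OF xy(1)] uv inj by (auto dest: inj_onD)
    then show "(u, v) \<in> parcs G" using xy arcs by simp
  qed
  have "\<exists>u \<in> verts H. iso_verts f u = i" if "i < 5" for i
    using iv that by (metis imageE lessThan_iff)
  then obtain g where g: "\<And>i. i < 5 \<Longrightarrow> g i \<in> verts H \<and> iso_verts f (g i) = i" by metis
  have gi: "g i = g j \<longleftrightarrow> i = j" if "i < 5" "j < 5" for i j using g that by metis
  have ga: "(g i, g j) \<in> parcs G \<longleftrightarrow> (i, j) \<in> parcs (cycle_graph 5)" if "i < 5" "j < 5" for i j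
    using adj g that by simp
  have "pentagon (\<lambda>u v. (u, v) \<in> parcs G) (g 0) (g 1) (g 2) (g 3) (g 4)"
    by (simp add: pentagon_def gi ga) (simp add: cycle_graph_def)
  moreover have "{g 0, g 1, g 2, g 3, g 4} \<subseteq> pverts G" using g sub by auto
  ultimately show ?thesis by blast
qed

text \<open>A pentagon is prime: the fibres of \<open>p\<close> are modules, and a fibre that holds
  two vertices of the pentagon absorbs the other three.\<close>

lemma pentagon_modules:
  assumes P: "pentagon E a b c d e"
    and sym: "\<And>u v. E u v \<longleftrightarrow> E v u"
    and module: "\<And>u v z. p u = p v \<Longrightarrow> p z \<noteq> p u \<Longrightarrow> E u z \<longleftrightarrow> E v z"
  shows "distinct [p a, p b, p c, p d, p e] \<or> (p a = p b \<and> p b = p c \<and> p c = p d \<and> p d = p e)"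
proof -
  \<comment> \<open>A vertex that tells two members of a fibre apart lies in that fibre.\<close>
  have sep: "p z = p u" if "p u = p v" "E u z" "\<not> E v z" for u v z
    using module[OF that(1), of z] that(2,3) by blast
  have edges: "E a b \<and> E b c \<and> E c d \<and> E a e"
    and non_edges: "\<not> E a c \<and> \<not> E c e \<and> \<not> E b e \<and> \<not> E d b \<and> \<not> E a d"
    if "pentagon E a b c d e" for a b c d e
    using that sym[of a e] sym[of b e] sym[of d b] sym[of a d] by (simp_all add: pentagon_def)
  \<comment> \<open>Both \<open>c\<close> and \<open>e\<close> tell \<open>a\<close> and
    \<open>b\<close> apart; then \<open>d\<close> tells \<open>c\<close> and \<open>a\<close>
    apart.\<close>
  have adjacent: "p b = p a \<and> p c = p a \<and> p d = p a \<and> p e = p a"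
    if P: "pentagon E a b c d e" and "p a = p b" for a b c d e
  proof -
    note edges[OF P] non_edges[OF P]
    moreover from this have "p c = p b" using sep[OF \<open>p a = p b\<close>[symmetric], of c] by blast
    moreover from calculation have "p e = p a" using sep[OF \<open>p a = p b\<close>, of e] by blast
    moreover from calculation have "p d = p c" using sep[of c a d] \<open>p a = p b\<close> by metis
    ultimately show ?thesis using \<open>p a = p b\<close> by metis
  qed
  \<comment> \<open>Both \<open>d\<close> and \<open>e\<close> tell \<open>a\<close> and
    \<open>c\<close> apart. The common neighbour \<open>b\<close> of \<open>a\<close> and
    \<open>c\<close> does not, but it tells \<open>a\<close> and \<open>d\<close> apart once
    \<open>d\<close> has joined.\<close>
  have nonadjacent: "p b = p a \<and> p c = p a \<and> p d = p a \<and> p e = p a"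
    if P: "pentagon E a b c d e" and "p a = p c" for a b c d e
  proof -
    note edges[OF P] non_edges[OF P]
    moreover from this have "p d = p c" using sep[OF \<open>p a = p c\<close>[symmetric], of d] by blast
    moreover from calculation have "p e = p a" using sep[OF \<open>p a = p c\<close>, of e] by blast
    moreover from calculation have "p b = p a" using sep[of a d b] \<open>p a = p c\<close> by metis
    ultimately show ?thesis using \<open>p a = p c\<close> by metis
  qed
  have rotate: "pentagon E b c d e a" if "pentagon E a b c d e" for a b c d e
    using that by (auto simp: pentagon_def)
  note P1 = rotate[OF P]
  note P2 = rotate[OF P1]
  note P3 = rotate[OF P2]
  note P4 = rotate[OF P3]
  \<comment> \<open>Rotation reduces the five sides to \<open>adjacent\<close> and the five
    diagonals to \<open>nonadjacent\<close>.\<close>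
  consider (0) "distinct [p a, p b, p c, p d, p e]"
    | (1) "p a = p b"
    | (2) "p b = p c"
    | (3) "p c = p d"
    | (4) "p d = p e"
    | (5) "p a = p e"
    | (6) "p a = p c"
    | (7) "p b = p d"
    | (8) "p c = p e"
    | (9) "p a = p d"
    | (10) "p b = p e"
    by auto
  then show ?thesis
  proof cases
    case 0
    then show ?thesis ..
  next
    case 1
    from adjacent[OF P this] show ?thesis by simp
  next
    case 2
    from adjacent[OF P1 this] show ?thesis by simp
  next
    case 3
    from adjacent[OF P2 this] show ?thesis by simp
  next
    case 4
    from adjacent[OF P3 this] show ?thesis by simp
  next
    case 5
    from adjacent[OF P4 this[symmetric]] show ?thesis by simp
  next
    case 6
    from nonadjacent[OF P this] show ?thesis by simp
  next
    case 7
    from nonadjacent[OF P1 this] show ?thesis by simp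
  next
    case 8
    from nonadjacent[OF P2 this] show ?thesis by simp
  next
    case 9
    from nonadjacent[OF P3 this[symmetric]] show ?thesis by simp
  next
    case 10
    from nonadjacent[OF P4 this[symmetric]] show ?thesis by simp
  qed
qed

text \<open>A closed walk of odd length cannot alternate between two colours. This serves bipartite
  classes directly and co-bipartite ones through the complementary pentagon.\<close>

lemma two_colouring_5_cycle:
  assumes "\<And>u v. E u v \<Longrightarrow> k u \<noteq> (k v :: bool)"
    and E: "E a b" "E b c" "E c d" "E d e" "E e a"
  shows False
proof -
  have "k a \<noteq> k b" "k b \<noteq> k c" "k c \<noteq> k d" "k d \<noteq> k e" "k e \<noteq> k a"
    using E by (auto dest!: assms(1))
  then show False by blast
qed

section \<open>Blow-ups of the rook graph\<close>

definition rook :: "nat \<Rightarrow> nat \<Rightarrow> bool" where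
  "rook p q \<longleftrightarrow> p \<noteq> q \<and> (p div 3 = q div 3 \<or> p mod 3 = q mod 3)"

text \<open>Bipartite with sides \<open>{..<s}\<close> and \<open>{s..<2 * s}\<close>; \<open>e\<close>-regular on \<open>{..<2 * s}\<close> if \<open>e \<le> s\<close>.\<close>

definition bicirculant :: "nat \<Rightarrow> nat \<Rightarrow> nat \<Rightarrow> nat \<Rightarrow> bool" where
  "bicirculant s e x y \<longleftrightarrow>
    (x < s \<and> s \<le> y \<and> y < 2 * s \<or> y < s \<and> s \<le> x \<and> x < 2 * s) \<and> (x + y) mod s < e"

text \<open>
  Vertex \<open>9 * x + p\<close> is the \<open>x\<close>-th member of class \<open>p < 9\<close>, which sits in row \<open>p div 3\<close> and column
  \<open>p mod 3\<close> and has size \<open>w p\<close>. Inside class \<open>p\<close> the graph is \<open>e p\<close>-regular bipartite, complemented if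
  \<open>c p\<close>; if \<open>w p\<close> is odd, the last member is isolated before complementation.
\<close>

definition blow_up_adj :: "(nat \<Rightarrow> nat) \<Rightarrow> (nat \<Rightarrow> bool) \<Rightarrow> (nat \<Rightarrow> nat) \<Rightarrow> nat \<Rightarrow> nat \<Rightarrow> bool" where
  "blow_up_adj w c e u v \<longleftrightarrow>
    (if u mod 9 = v mod 9
     then u \<noteq> v \<and> bicirculant (w (u mod 9) div 2) (e (u mod 9)) (u div 9) (v div 9) \<noteq> c (u mod 9)
     else rook (u mod 9) (v mod 9))"

definition blow_up :: "(nat \<Rightarrow> nat) \<Rightarrow> (nat \<Rightarrow> bool) \<Rightarrow> (nat \<Rightarrow> nat) \<Rightarrow> nat pair_pre_digraph" where
  "blow_up w c e =
    \<lparr> pverts = {v. v div 9 < w (v mod 9)},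
      parcs = {(u, v). u div 9 < w (u mod 9) \<and> v div 9 < w (v mod 9) \<and> blow_up_adj w c e u v} \<rparr>"

lemma rook_sym: "rook p q \<longleftrightarrow> rook q p"
  by (auto simp: rook_def)

lemma bicirculant_sym: "bicirculant s e x y \<longleftrightarrow> bicirculant s e y x"
  by (auto simp: bicirculant_def add.commute)

lemma blow_up_adj_sym: "blow_up_adj w c e u v \<longleftrightarrow> blow_up_adj w c e v u"
  using rook_sym bicirculant_sym by (auto simp: blow_up_adj_def)

lemma blow_up_adj_irrefl: "\<not> blow_up_adj w c e v v"
  by (simp add: blow_up_adj_def)

text \<open>Around a pentagon, the edges along rows and along columns would have to alternate.\<close>

lemma no_pentagon_rook: "\<not> pentagon rook a b c d e"
proof
  assume P: "pentagon rook a b c d e"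
  define r where "r x y \<longleftrightarrow> x div 3 = y div (3::nat)" for x y :: nat
  define k where "k x y \<longleftrightarrow> x mod 3 = y mod (3::nat)" for x y :: nat
  have rr: "r x y \<Longrightarrow> r y z \<Longrightarrow> r x z" and kk: "k x y \<Longrightarrow> k y z \<Longrightarrow> k x z" for x y z
    by (simp_all add: r_def k_def)
  have "r a b \<or> k a b" "r b c \<or> k b c" "r c d \<or> k c d" "r d e \<or> k d e" "r e a \<or> k e a"
    and sep: "\<not> r a c" "\<not> k a c" "\<not> r c e" "\<not> k c e" "\<not> r e b" "\<not> k e b"
      "\<not> r b d" "\<not> k b d" "\<not> r d a" "\<not> k d a"
    using P by (auto simp: pentagon_def rook_def r_def k_def)
  \<comment> \<open>Consecutive edges along the same kind of line would, by transitivity, put their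
    non-adjacent outer ends on a common line. What is left is propositional.\<close>
  moreover have "\<not> (r a b \<and> r b c)" "\<not> (r b c \<and> r c d)" "\<not> (r c d \<and> r d e)" "\<not> (r d e \<and> r e a)"
    "\<not> (r e a \<and> r a b)" "\<not> (k a b \<and> k b c)" "\<not> (k b c \<and> k c d)" "\<not> (k c d \<and> k d e)"
    "\<not> (k d e \<and> k e a)" "\<not> (k e a \<and> k a b)"
    using sep rr kk by blast+
  ultimately show False by satx
qed

text \<open>The classes are modules, so a pentagon either meets five classes and projects to one in
  the rook graph, or lies inside a single class.\<close>

lemma no_pentagon_blow_up: "\<not> pentagon (blow_up_adj w c e) x1 x2 x3 x4 x5"
proof
  let ?E = "blow_up_adj w c e"
  assume P: "pentagon ?E x1 x2 x3 x4 x5"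
  have module: "?E u z \<longleftrightarrow> ?E v z" if "u mod 9 = v mod 9" "z mod 9 \<noteq> u mod 9" for u v z
    using that by (simp add: blow_up_adj_def)
  consider (distinct) "distinct [x1 mod 9, x2 mod 9, x3 mod 9, x4 mod 9, x5 mod 9]"
    | (equal) "x1 mod 9 = x2 mod 9" "x2 mod 9 = x3 mod 9" "x3 mod 9 = x4 mod 9" "x4 mod 9 = x5 mod 9"
    using pentagon_modules[where p = "\<lambda>v. v mod 9", OF P blow_up_adj_sym module] by blast
  then show False
  proof cases
    case distinct
    have "?E u v \<longleftrightarrow> rook (u mod 9) (v mod 9)" if "u mod 9 \<noteq> v mod 9" for u v
      using that by (simp add: blow_up_adj_def)
    moreover have "x5 mod 9 \<noteq> x1 mod 9" "x5 mod 9 \<noteq> x2 mod 9" "x4 mod 9 \<noteq> x1 mod 9"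
      using distinct by auto
    ultimately have "pentagon rook (x1 mod 9) (x2 mod 9) (x3 mod 9) (x4 mod 9) (x5 mod 9)"
      using P distinct unfolding pentagon_def by simp
    then show False using no_pentagon_rook by blast
  next
    case equal
    define q where "q = x1 mod 9"
    define C where "C u v = bicirculant (w q div 2) (e q) (u div 9) (v div 9)" for u v
    have q: "x1 mod 9 = q" "x2 mod 9 = q" "x3 mod 9 = q" "x4 mod 9 = q" "x5 mod 9 = q"
      using equal by (simp_all add: q_def)
    have E: "?E u v \<longleftrightarrow> u \<noteq> v \<and> C u v \<noteq> c q" if "u mod 9 = q" "v mod 9 = q" for u v
      using that by (simp add: blow_up_adj_def C_def)
    have bipartite: "(u div 9 < w q div 2) \<noteq> (v div 9 < w q div 2)" if "C u v" for u v
      using that by (auto simp: C_def bicirculant_def)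
    show False
    proof (cases "c q")
      case False
      then have "C x1 x2" "C x2 x3" "C x3 x4" "C x4 x5" "C x5 x1"
        using P by (auto simp: pentagon_def E q)
      from two_colouring_5_cycle[of C, OF bipartite this] show False .
    next
      case True
      \<comment> \<open>In a complemented class, the non-edges of the pentagon form a 5-cycle of the
        bipartite graph.\<close>
      then have "C x1 x3" "C x3 x5" "C x5 x2" "C x2 x4" "C x4 x1"
        using P by (auto simp: pentagon_def E q)
      from two_colouring_5_cycle[of C, OF bipartite this] show False .
    qed
  qed
qed

lemma no_induced_5_cycle_blow_up: "\<not> has_induced_cycle 5 (blow_up w c e)"
proof
  assume "has_induced_cycle 5 (blow_up w c e)"
  then obtain x1 x2 x3 x4 x5 where V: "{x1, x2, x3, x4, x5} \<subseteq> pverts (blow_up w c e)"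
    and P: "pentagon (\<lambda>u v. (u, v) \<in> parcs (blow_up w c e)) x1 x2 x3 x4 x5"
    using has_induced_cycle_5_pentagon by blast
  have "(u, v) \<in> parcs (blow_up w c e) \<longleftrightarrow> blow_up_adj w c e u v"
    if "u \<in> pverts (blow_up w c e)" "v \<in> pverts (blow_up w c e)" for u v
    using that by (simp add: blow_up_def)
  then have "pentagon (blow_up_adj w c e) x1 x2 x3 x4 x5"
    using V P by (simp add: pentagon_def)
  then show False using no_pentagon_blow_up by blast
qed

section \<open>Order and degrees of a blow-up\<close>

lemma sum_blow_up:
  fixes f :: "nat \<Rightarrow> 'b::comm_monoid_add"
  shows "(\<Sum>v | v div 9 < w (v mod 9). f v) = (\<Sum>p<9. \<Sum>x<w p. f (9 * x + p))"
proof -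
  have "(\<Sum>p<9. \<Sum>x<w p. f (9 * x + p)) = (\<Sum>(p, x)\<in>(SIGMA p:{..<9}. {..<w p}). f (9 * x + p))"
    by (rule sum.Sigma) auto
  also have "\<dots> = (\<Sum>v | v div 9 < w (v mod 9). f v)"
    \<comment> \<open>Division by 9 with remainder splits a vertex into its position and its
      class.\<close>
    by (rule sum.reindex_bij_witness[where i = "\<lambda>v. (v mod 9, v div 9)" and j = "\<lambda>(p, x). 9 * x + p"])
      auto
  finally show ?thesis ..
qed

lemma finite_blow_up: "finite {v. v div 9 < w (v mod 9)}" for w :: "nat \<Rightarrow> nat"
proof -
  have "{v. v div 9 < w (v mod 9)} = (\<lambda>(p, x). 9 * x + p) ` (SIGMA p:{..<9}. {..<w p})"
  proof (intro equalityI subsetI)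
    fix v assume "v \<in> {v. v div 9 < w (v mod 9)}"
    then show "v \<in> (\<lambda>(p, x). 9 * x + p) ` (SIGMA p:{..<9}. {..<w p})"
      by (intro image_eqI[of _ _ "(v mod 9, v div 9)"]) auto
  qed auto
  then show ?thesis by simp
qed

lemma card_blow_up: "card (pverts (blow_up w c e)) = (\<Sum>p<9. w p)"
  using sum_blow_up[of "\<lambda>_. 1::nat" w] by (simp add: blow_up_def)

lemma pair_graph_blow_up: "pair_graph (blow_up w c e)"
proof
  let ?G = "blow_up w c e"
  show fin: "finite (pverts ?G)"
    using finite_blow_up by (simp add: blow_up_def)
  have "parcs ?G \<subseteq> pverts ?G \<times> pverts ?G" by (auto simp: blow_up_def)
  then show "finite (parcs ?G)" using fin finite_subset by blast
  show "symmetric (with_proj ?G)"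
    using blow_up_adj_sym by (auto simp: symmetric_def sym_def blow_up_def)
  fix a assume a: "a \<in> parcs ?G"
  then show "fst a \<in> pverts ?G" "snd a \<in> pverts ?G" by (auto simp: blow_up_def)
  show "fst a \<noteq> snd a" using a blow_up_adj_irrefl by (auto simp: blow_up_def)
qed

text \<open>Among \<open>s\<close> consecutive integers each residue modulo \<open>s\<close> occurs
  once. The case \<open>s = 0\<close> arises for classes of size 1 and forces
  \<open>e = 0\<close>.\<close>

lemma card_mod_less_period:
  fixes s :: nat
  assumes "e \<le> s"
  shows "card {y \<in> {m..<m + s}. (x + y) mod s < e} = e"
proof (cases "s = 0")
  case False
  let ?f = "\<lambda>y. (x + y) mod s"
  have inj: "inj_on ?f {m..<m + s}"
  proof (rule linorder_inj_onI')
    fix y z assume yz: "y \<in> {m..<m + s}" "z \<in> {m..<m + s}" "y < z"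
    then have "\<not> s dvd z - y" by (auto dest: dvd_imp_le)
    then have "\<not> s dvd (x + z) - (x + y)" by simp
    then have "(x + z) mod s \<noteq> (x + y) mod s"
      using yz(3) mod_eq_dvd_iff_nat[of "x + y" "x + z" s] by simp
    then show "(x + y) mod s \<noteq> (x + z) mod s" by simp
  qed
  have "?f ` {m..<m + s} \<subseteq> {..<s}" using False by auto
  then have surj: "?f ` {m..<m + s} = {..<s}"
    using card_image[OF inj] by (intro card_subset_eq) simp_all
  have "?f ` {y \<in> {m..<m + s}. ?f y < e} = {z \<in> ?f ` {m..<m + s}. z < e}" by blast
  also have "\<dots> = {..<e}" unfolding surj using assms by auto
  finally have "card (?f ` {y \<in> {m..<m + s}. ?f y < e}) = e" by simp
  moreover have "inj_on ?f {y \<in> {m..<m + s}. ?f y < e}"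
    using inj by (rule inj_on_subset) blast
  ultimately show ?thesis by (simp add: card_image)
qed (use assms in simp)

text \<open>The side opposite to \<open>x\<close> is one full period of length \<open>s\<close>; a
  position from \<open>2 * s\<close> on, such as the last of an odd class, has no neighbour.\<close>

lemma card_bicirculant:
  assumes "e \<le> s" "2 * s \<le> w"
  shows "card {y. y < w \<and> bicirculant s e x y} = (if x < 2 * s then e else 0)"
proof -
  consider (low) "x < s" | (high) "s \<le> x" "x < 2 * s" | (outside) "2 * s \<le> x" by linarith
  then show ?thesis
  proof cases
    case low
    then have "{y. y < w \<and> bicirculant s e x y} = {y \<in> {s..<s + s}. (x + y) mod s < e}"
      using assms by (auto simp: bicirculant_def)
    then show ?thesis using card_mod_less_period[OF assms(1), of s x] low by simp
  next
    case high
    then have "{y. y < w \<and> bicirculant s e x y} = {y \<in> {0..<0 + s}. (x + y) mod s < e}"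
      using assms by (auto simp: bicirculant_def)
    then show ?thesis using card_mod_less_period[OF assms(1), of 0 x] high by simp
  next
    case outside
    then have "{y. y < w \<and> bicirculant s e x y} = {}"
      by (auto simp: bicirculant_def)
    then show ?thesis using outside by simp
  qed
qed

text \<open>This is the share of a degree in class \<open>p\<close> that comes from the other
  classes.\<close>

definition rook_weight :: "(nat \<Rightarrow> nat) \<Rightarrow> nat \<Rightarrow> nat" where
  "rook_weight w p = (\<Sum>q<9. if rook p q then w q else 0)"

text \<open>A vertex sees all of every rook-adjacent class. In its own class it has \<open>b\<close>
  neighbours, or all members but itself and those \<open>b\<close> after complementation.\<close>

lemma degree_blow_up:
  assumes v: "v \<in> pverts (blow_up w c e)" and p: "v mod 9 = p" and e: "e p \<le> w p div 2"
  defines "b \<equiv> if v div 9 < 2 * (w p div 2) then e p else 0"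
  shows "degree (blow_up w c e) v = rook_weight w p + (if c p then w p - 1 - b else b)"
proof -
  let ?E = "blow_up_adj w c e" and ?V = "{u. u div 9 < w (u mod 9)}" and ?x = "v div 9"
  let ?C = "\<lambda>y. bicirculant (w p div 2) (e p) ?x y"
  have p9: "p < 9" and x: "?x < w p" using v p by (auto simp: blow_up_def)
  have v_eq: "9 * ?x + p = v" using p by auto
  have "out_arcs (with_proj (blow_up w c e)) v = Pair v ` {u \<in> ?V. ?E v u}"
    using v by (auto simp: out_arcs_def blow_up_def)
  then have "degree (blow_up w c e) v = card {u \<in> ?V. ?E v u}"
    by (simp add: degree_def out_degree_def card_image inj_on_def)
  also have "\<dots> = (\<Sum>u\<in>?V. if ?E v u then 1 else 0)"
    using finite_blow_up[of w] by (simp add: sum.If_cases Int_def)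
  also have "\<dots> = (\<Sum>q<9. \<Sum>y<w q. if ?E v (9 * y + q) then 1 else 0)"
    by (rule sum_blow_up)
  \<comment> \<open>As \<open>rook p p\<close> is false, the outer and inner shares can be added in
    one sum.\<close>
  also have "\<dots> = (\<Sum>q<9. (if rook p q then w q else 0) +
      (if q = p then card {y. y < w p \<and> y \<noteq> ?x \<and> ?C y \<noteq> c p} else 0))"
  proof (rule sum.cong[OF refl])
    fix q assume "q \<in> {..<9::nat}"
    then have q9: "q < 9" by simp
    show "(\<Sum>y<w q. if ?E v (9 * y + q) then 1 else 0) = (if rook p q then w q else 0) +
      (if q = p then card {y. y < w p \<and> y \<noteq> ?x \<and> ?C y \<noteq> c p} else 0)"
    proof (cases "q = p")
      case True
      have "?E v (9 * y + p) \<longleftrightarrow> y \<noteq> ?x \<and> ?C y \<noteq> c p" for y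
        using p p9 v_eq by (auto simp: blow_up_adj_def)
      then show ?thesis using True
        by (simp add: rook_def sum.If_cases Int_def)
    next
      case False
      then have "?E v (9 * y + q) \<longleftrightarrow> rook p q" for y
        using p q9 by (simp add: blow_up_adj_def)
      then show ?thesis using False by simp
    qed
  qed
  also have "\<dots> = rook_weight w p + card {y. y < w p \<and> y \<noteq> ?x \<and> ?C y \<noteq> c p}"
    using p9 by (simp add: rook_weight_def sum.distrib)
  also have "card {y. y < w p \<and> y \<noteq> ?x \<and> ?C y \<noteq> c p} = (if c p then w p - 1 - b else b)"
  proof -
    have b: "card {y. y < w p \<and> ?C y} = b"
      using card_bicirculant[of "e p" "w p div 2" "w p" ?x] e by (simp add: b_def)
    have irrefl: "\<not> ?C ?x" by (auto simp: bicirculant_def)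
    show ?thesis
    proof (cases "c p")
      case True
      have "{y. y < w p \<and> y \<noteq> ?x \<and> ?C y \<noteq> c p} = ({..<w p} - {?x}) - {y. y < w p \<and> ?C y}"
        using True by auto
      moreover have "{y. y < w p \<and> ?C y} \<subseteq> {..<w p} - {?x}" using irrefl by auto
      ultimately show ?thesis using True x b by (simp add: card_Diff_subset)
    next
      case False
      have "{y. y < w p \<and> y \<noteq> ?x \<and> ?C y \<noteq> c p} = {y. y < w p \<and> ?C y}"
        using False irrefl by auto
      then show ?thesis using False b by simp
    qed
  qed
  finally show ?thesis .
qed

text \<open>Only the last member of an odd class can deviate, and only if \<open>e p\<close> is
  nonzero; \<open>exceptional\<close> excludes exactly this.\<close>

lemma degree_blow_up_typical:
  assumes "v \<in> pverts (blow_up w c e)" and p: "v mod 9 = p" and "e p \<le> w p div 2"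
    and exceptional: "odd (w p) \<Longrightarrow> e p = 0 \<or> v \<noteq> 9 * (w p - 1) + p"
  shows "degree (blow_up w c e) v = rook_weight w p + (if c p then w p - 1 - e p else e p)"
proof -
  have "v div 9 < 2 * (w p div 2)" if "e p \<noteq> 0"
  proof (cases "even (w p)")
    case True
    then show ?thesis using assms(1) p by (simp add: blow_up_def)
  next
    case False
    then have "v div 9 \<noteq> w p - 1" using exceptional that p by (metis mult_div_mod_eq)
    moreover have "v div 9 < w p" using assms(1) p by (simp add: blow_up_def)
    ultimately show ?thesis using False by (auto elim!: oddE)
  qed
  then show ?thesis using degree_blow_up[of v w c e p] assms by (cases "e p = 0") auto
qed

lemma less_9_iff: "p < 9 \<longleftrightarrow> p \<in> {0, 1, 2, 3, 4, 5, 6, 7, 8}" for p :: nat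
  by auto

lemma all_less_9:
  "(\<forall>p<9. P p) \<longleftrightarrow> P 0 \<and> P 1 \<and> P 2 \<and> P 3 \<and> P 4 \<and> P 5 \<and> P 6 \<and> P 7 \<and> P (8::nat)"
  unfolding less_9_iff Ball_def[symmetric] by simp

lemma sum_less_9: "(\<Sum>p<9. f p) = f 0 + f 1 + f 2 + f 3 + f 4 + f 5 + f 6 + f 7 + f (8::nat)"
  for f :: "nat \<Rightarrow> nat"
  by (simp add: eval_nat_numeral)

lemma regular_blow_up:
  assumes "\<forall>p<9. e p \<le> w p div 2 \<and> (odd (w p) \<longrightarrow> e p = 0) \<and>
      rook_weight w p + (if c p then w p - 1 - e p else e p) = d"
  shows "regular d (blow_up w c e)"
  unfolding regular_def
proof
  fix v assume v: "v \<in> pverts (blow_up w c e)"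
  have "v mod 9 < 9" by simp
  then show "degree (blow_up w c e) v = d"
    using degree_blow_up_typical[OF v refl] assms by simp
qed

text \<open>In class \<open>q\<close> the last member is isolated before complementation while the
  others have inner degree 1. It ends one below \<open>d\<close>, or one above \<open>d\<close> if
  the class is complemented.\<close>

lemma almost_regular_blow_up:
  assumes q: "q < 9" "odd (w q)" "e q = 1"
    and deg: "\<forall>p<9. e p \<le> w p div 2 \<and> (odd (w p) \<longrightarrow> p = q \<or> e p = 0) \<and>
      rook_weight w p + (if c p then w p - 1 - e p else e p) = d"
  shows "almost_regular d (blow_up w c e)"
proof -
  let ?G = "blow_up w c e" and ?s = "9 * (w q - 1) + q"
  have s: "?s \<in> pverts ?G" "?s mod 9 = q" using q odd_pos[of "w q"] by (auto simp: blow_up_def)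
  \<comment> \<open>Hence \<open>w q - 1 - 1\<close> is not truncated.\<close>
  have "1 \<le> w q div 2" using q(1,3) deg by auto
  have s_div: "?s div 9 = 2 * (w q div 2)" using q by (auto elim!: oddE)
  have "e q \<le> w q div 2" using q(1) deg by auto
  from degree_blow_up[OF s this] have "degree ?G ?s = rook_weight w q + (if c q then w q - 1 else 0)"
    unfolding s_div by simp
  moreover have "rook_weight w q + (if c q then w q - 1 - 1 else 1) = d"
    using q deg by auto
  ultimately have "degree ?G ?s = d + 1 \<or> degree ?G ?s + 1 = d"
    using \<open>1 \<le> w q div 2\<close> by (auto split: if_splits)
  moreover have "degree ?G v = d" if v: "v \<in> pverts ?G - {?s}" for v
  proof -
    have p9: "v mod 9 < 9" by simp
    have "e (v mod 9) = 0 \<or> v \<noteq> 9 * (w (v mod 9) - 1) + v mod 9" if "odd (w (v mod 9))"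
      using deg[rule_format, OF p9] v that by auto
    then show ?thesis
      using degree_blow_up_typical[of v w c e "v mod 9"] deg[rule_format, OF p9] v by simp
  qed
  ultimately show ?thesis using s unfolding almost_regular_def by blast
qed

section \<open>Parameter tables\<close>

definition balanced_graph_exists :: "nat \<Rightarrow> bool" where
  "balanced_graph_exists n \<longleftrightarrow> (\<exists>G :: nat pair_pre_digraph.
    pair_graph G \<and> card (pverts G) = n \<and> \<not> has_induced_cycle 5 G \<and>
    (n mod 4 = 1 \<longrightarrow> regular ((n - 1) div 2) G) \<and>
    (n mod 4 = 3 \<longrightarrow> almost_regular ((n - 1) div 2) G))"

text \<open>Existence is reduced to arithmetic on a table: the order and one degree equation per
  class.\<close>

lemma regular_exists:
  assumes "(\<Sum>p<9. w p) = n"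
    and "n mod 4 = 1"
    and "\<forall>p<9. e p \<le> w p div 2 \<and> (odd (w p) \<longrightarrow> e p = 0) \<and>
      rook_weight w p + (if c p then w p - 1 - e p else e p) = (n - 1) div 2"
  shows "balanced_graph_exists n"
  unfolding balanced_graph_exists_def
  using assms pair_graph_blow_up card_blow_up no_induced_5_cycle_blow_up regular_blow_up[OF assms(3)]
  by (intro exI[of _ "blow_up w c e"]) auto

lemma almost_regular_exists:
  assumes "(\<Sum>p<9. w p) = n" and "n mod 4 = 3"
    and "q < 9" "odd (w q)" "e q = 1"
    and "\<forall>p<9. e p \<le> w p div 2 \<and> (odd (w p) \<longrightarrow> p = q \<or> e p = 0) \<and>
      rook_weight w p + (if c p then w p - 1 - e p else e p) = (n - 1) div 2"
  shows "balanced_graph_exists n"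
  unfolding balanced_graph_exists_def
  using assms pair_graph_blow_up card_blow_up no_induced_5_cycle_blow_up
    almost_regular_blow_up[where w = w and c = c and e = e, OF assms(3-6)]
  by (intro exI[of _ "blow_up w c e"]) auto

lemmas rook_simps = all_less_9 sum_less_9 rook_weight_def rook_def

text \<open>The four neighbours of the one-vertex class 0 are cliques, the other four classes
  independent sets. A clique member has degree \<open>(3 * a + 1) + (a - 1)\<close>, which is
  \<open>4 * a\<close> as \<open>a\<close> is positive; all others have four neighbouring classes of
  size \<open>a\<close>.\<close>

lemma balanced_8a_plus_1:
  assumes "0 < a"
  shows "balanced_graph_exists (8 * a + 1)"
  by (rule regular_exists[where
      w = "(!) [1, a, a, a, a, a, a, a, a]" and
      c = "(!) [False, True, True, True, False, False, True, False, False]" and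
      e = "(!) [0, 0, 0, 0, 0, 0, 0, 0, 0]"])
    (use assms in \<open>simp_all add: rook_simps\<close>, presburger)

text \<open>The orders 19, 21, 23, 29 and 45 lie below the start of the family for their residue
  modulo 16 and get tables of their own.\<close>

lemma balanced_19:
  shows "balanced_graph_exists (19)"
  by (rule almost_regular_exists[where q = 8 and
      w = "(!) [2, 2, 2, 2, 2, 2, 2, 2, 3]" and
      c = "(!) [True, True, False, True, True, False, False, False, False]" and
      e = "(!) [0, 0, 0, 0, 0, 0, 0, 0, 1]"])
    (simp_all add: rook_simps)

lemma balanced_21:
  shows "balanced_graph_exists (21)"
  by (rule regular_exists[where
      w = "(!) [2, 2, 2, 2, 2, 2, 3, 3, 3]" and
      c = "(!) [True, True, True, True, True, True, False, False, False]" and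
      e = "(!) [0, 0, 0, 0, 0, 0, 0, 0, 0]"])
    (simp_all add: rook_simps)

lemma balanced_23:
  shows "balanced_graph_exists (23)"
  by (rule almost_regular_exists[where q = 6 and
      w = "(!) [2, 2, 3, 2, 3, 2, 3, 3, 3]" and
      c = "(!) [True, False, True, True, True, False, False, False, False]" and
      e = "(!) [0, 0, 0, 0, 0, 0, 1, 0, 0]"])
    (simp_all add: rook_simps)

lemma balanced_29:
  shows "balanced_graph_exists (29)"
  by (rule regular_exists[where
      w = "(!) [2, 3, 3, 3, 4, 4, 4, 3, 3]" and
      c = "(!) [True, True, True, False, False, False, True, False, False]" and
      e = "(!) [0, 0, 0, 0, 1, 1, 0, 0, 0]"])
    (simp_all add: rook_simps)

lemma balanced_45:
  shows "balanced_graph_exists (45)"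
  by (rule regular_exists[where
      w = "(!) [3, 4, 6, 4, 5, 5, 6, 5, 7]" and
      c = "(!) [True, True, True, True, True, False, True, False, False]" and
      e = "(!) [0, 0, 2, 0, 0, 0, 2, 0, 0]"])
    (simp_all add: rook_simps)

text \<open>When \<open>a\<close> grows by 1, class 0 and its non-neighbours gain 8 from four
  growing neighbour classes; the neighbours of class 0 gain 6 from three such classes and 2 from
  their own complemented class. Parities of the sizes do not change.\<close>

lemma balanced_16a_plus_31:
  shows "balanced_graph_exists (16 * a + 31)"
  by (rule almost_regular_exists[where q = 1 and
      w = "(!) [2, 2 * a + 3, 2 * a + 4, 2 * a + 3, 2 * a + 4, 2 * a + 3, 2 * a + 4, 2 * a + 4, 2 * a + 4]" and
      c = "(!) [True, True, True, True, False, False, True, False, False]" and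
      e = "(!) [0, 1, 0, 0, 2, 0, 1, 0, 0]"])
    (simp_all add: rook_simps, presburger)

lemma balanced_16a_plus_35:
  shows "balanced_graph_exists (16 * a + 35)"
  by (rule almost_regular_exists[where q = 8 and
      w = "(!) [2, 2 * a + 4, 2 * a + 4, 2 * a + 4, 2 * a + 4, 2 * a + 4, 2 * a + 4, 2 * a + 4, 2 * a + 5]" and
      c = "(!) [True, True, True, True, False, False, True, False, False]" and
      e = "(!) [0, 0, 1, 0, 1, 0, 1, 0, 1]"])
    (simp_all add: rook_simps, presburger)

lemma balanced_16a_plus_37:
  shows "balanced_graph_exists (16 * a + 37)"
  by (rule regular_exists[where
      w = "(!) [3, 2 * a + 4, 2 * a + 4, 2 * a + 4, 2 * a + 4, 2 * a + 4, 2 * a + 4, 2 * a + 4, 2 * a + 6]" and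
      c = "(!) [True, True, True, True, False, False, True, False, False]" and
      e = "(!) [0, 0, 2, 0, 2, 0, 2, 0, 2]"])
    (simp_all add: rook_simps, presburger)

text \<open>Here the exceptional vertex lies in the class of fixed size, which is one edge and an
  isolated vertex.\<close>

lemma balanced_16a_plus_39:
  shows "balanced_graph_exists (16 * a + 39)"
  by (rule almost_regular_exists[where q = 0 and
      w = "(!) [3, 2 * a + 4, 2 * a + 4, 2 * a + 4, 2 * a + 4, 2 * a + 4, 2 * a + 6, 2 * a + 5, 2 * a + 5]" and
      c = "(!) [False, True, True, True, False, False, True, False, False]" and
      e = "(!) [1, 0, 0, 1, 2, 2, 3, 0, 0]"])
    (simp_all add: rook_simps, presburger)

lemma balanced_16a_plus_43:
  shows "balanced_graph_exists (16 * a + 43)"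
  by (rule almost_regular_exists[where q = 5 and
      w = "(!) [3, 2 * a + 4, 2 * a + 5, 2 * a + 4, 2 * a + 6, 2 * a + 5, 2 * a + 6, 2 * a + 5, 2 * a + 5]" and
      c = "(!) [True, True, True, True, False, False, True, False, False]" and
      e = "(!) [0, 1, 0, 2, 3, 1, 1, 0, 0]"])
    (simp_all add: rook_simps, presburger)

lemma balanced_16a_plus_61:
  shows "balanced_graph_exists (16 * a + 61)"
  by (rule regular_exists[where
      w = "(!) [3, 2 * a + 6, 2 * a + 8, 2 * a + 6, 2 * a + 8, 2 * a + 6, 2 * a + 8, 2 * a + 8, 2 * a + 8]" and
      c = "(!) [True, True, True, True, False, False, True, False, False]" and
      e = "(!) [0, 2, 0, 0, 4, 0, 2, 0, 0]"])
    (simp_all add: rook_simps, presburger)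

section \<open>Triangles and anti-triangles\<close>

lemma card_Collect_triple:
  assumes "x \<noteq> y" "y \<noteq> z" "x \<noteq> z"
  shows "card {v \<in> {x, y, z}. P v} = of_bool (P x) + of_bool (P y) + of_bool (P z)"
proof -
  have "card {v \<in> {x, y, z}. P v} = (\<Sum>v\<in>{x, y, z}. of_bool (P v))"
    by (simp add: Int_def conj_commute)
  then show ?thesis using assms by simp
qed

text \<open>
  Goodman's identity: a triple of vertices which is neither a triangle nor an anti-triangle has
  exactly two vertices that are adjacent to precisely one of the other two.
\<close>

lemma goodman:
  assumes "pair_graph G"
  defines "n \<equiv> card (pverts G)"
  shows "2 * (n choose 3) = 2 * (card (triangles G) + card (anti_triangles G)) +
    (\<Sum>v\<in>pverts G. degree G v * (n - 1 - degree G v))"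
proof -
  interpret pair_graph G by fact
  let ?E = "\<lambda>u v. (u, v) \<in> parcs G"
  define Tr where "Tr = {T. T \<subseteq> pverts G \<and> card T = 3}"
  \<comment> \<open>The vertex \<open>v\<close> sends one edge and one non-edge into
    \<open>T\<close>; the absence of loops makes \<open>a\<close> differ from
    \<open>v\<close>.\<close>
  define mixed where "mixed T v \<longleftrightarrow> v \<in> T \<and> (\<exists>a\<in>T. ?E v a) \<and> (\<exists>b\<in>T. b \<noteq> v \<and> \<not> ?E v b)" for T v
  have sym: "?E u v \<longleftrightarrow> ?E v u" for u v
    using pair_sym_arcs by (auto simp: symmetric_def sym_def)
  have irrefl: "\<not> ?E v v" for v
    using pair_no_loops by fastforce
  have finV: "finite (pverts G)" by (rule pair_finite_verts)
  have finTr: "finite Tr" unfolding Tr_def using finV by simp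
  have sub: "triangles G \<subseteq> Tr" "anti_triangles G \<subseteq> Tr"
    by (auto simp: triangles_def anti_triangles_def Tr_def)
  have disj: "triangles G \<inter> anti_triangles G = {}"
  proof -
    have False if "T \<in> triangles G" "T \<in> anti_triangles G" for T
    proof -
      from that obtain x y z where "T = {x, y, z}" "x \<noteq> y"
        by (auto simp: triangles_def card_3_iff)
      then show False using that by (auto simp: triangles_def anti_triangles_def)
    qed
    then show ?thesis by blast
  qed
  have fin_un: "finite (triangles G \<union> anti_triangles G)"
    using sub finTr finite_subset by blast
  then have card_un:
      "card (triangles G \<union> anti_triangles G) = card (triangles G) + card (anti_triangles G)"
    using disj by (simp add: card_Un_disjoint)
  have count: "card {v \<in> pverts G. mixed T v} =
      (if T \<in> triangles G \<union> anti_triangles G then 0 else 2)" if T: "T \<in> Tr" for T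
  proof -
    from T obtain x y z where xyz: "T = {x, y, z}" "x \<noteq> y" "y \<noteq> z" "x \<noteq> z"
      by (auto simp: Tr_def card_3_iff)
    have "{v \<in> pverts G. mixed T v} = {v \<in> {x, y, z}. mixed T v}"
      using T by (auto simp: Tr_def mixed_def xyz(1))
    then have "card {v \<in> pverts G. mixed T v} =
        of_bool (mixed T x) + of_bool (mixed T y) + of_bool (mixed T z)"
      using card_Collect_triple xyz(2-4) by metis
    \<comment> \<open>Each vertex compares two of the three pairs. If the three truth values are not
      all equal, exactly two comparisons differ.\<close>
    moreover have "mixed T x \<longleftrightarrow> ?E x y \<noteq> ?E x z" "mixed T y \<longleftrightarrow> ?E x y \<noteq> ?E y z"
      "mixed T z \<longleftrightarrow> ?E x z \<noteq> ?E y z"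
      using xyz irrefl sym[of y x] sym[of z x] sym[of z y] by (auto simp: mixed_def)
    moreover have "T \<in> triangles G \<longleftrightarrow> ?E x y \<and> ?E x z \<and> ?E y z"
      "T \<in> anti_triangles G \<longleftrightarrow> \<not> ?E x y \<and> \<not> ?E x z \<and> \<not> ?E y z"
      using T xyz sym[of y x] sym[of z x] sym[of z y]
      by (auto simp: triangles_def anti_triangles_def Tr_def)
    ultimately show ?thesis by auto
  qed
  \<comment> \<open>A triple that is mixed at \<open>v\<close> amounts to a choice of one neighbour
    and one non-neighbour of \<open>v\<close>.\<close>
  have pairs: "card {T \<in> Tr. mixed T v} = degree G v * (n - 1 - degree G v)"
    if v: "v \<in> pverts G" for v
  proof -
    define N where "N = {a. ?E v a}"
    define N' where "N' = {b \<in> pverts G. b \<noteq> v \<and> \<not> ?E v b}"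
    have N: "N \<subseteq> pverts G - {v}" and N': "N' = (pverts G - {v}) - N"
      using irrefl in_arcsD2 by (auto simp: N_def N'_def)
    have finN: "finite N" using N finV finite_subset by blast
    have "out_arcs (with_proj G) v = Pair v ` N"
      by (auto simp: out_arcs_def N_def)
    then have deg: "degree G v = card N"
      by (simp add: degree_def out_degree_def card_image inj_on_def)
    have card_N': "card N' = n - 1 - card N"
      using N' N finN finV v by (simp add: card_Diff_subset n_def)
    have "bij_betw (\<lambda>(a, b). {v, a, b}) (N \<times> N') {T \<in> Tr. mixed T v}"
    proof (rule bij_betw_imageI)
      show "inj_on (\<lambda>(a, b). {v, a, b}) (N \<times> N')"
      proof (rule inj_onI)
        fix x y assume xy: "x \<in> N \<times> N'" "y \<in> N \<times> N'"
          and eq: "(case x of (a, b) \<Rightarrow> {v, a, b}) = (case y of (a, b) \<Rightarrow> {v, a, b})"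
        have ne: "v \<notin> N" "v \<notin> N'" "\<And>u. u \<in> N \<Longrightarrow> u \<notin> N'" using N N' by auto
        \<comment> \<open>Intersecting the triple with \<open>N\<close> and \<open>N'\<close> gives
          back the two chosen vertices.\<close>
        have recover: "{v, a, b} \<inter> N = {a} \<and> {v, a, b} \<inter> N' = {b}" if "a \<in> N" "b \<in> N'" for a b
          using that ne by auto
        obtain a b a' b' where x: "x = (a, b)" and y: "y = (a', b')" by (metis surj_pair)
        then have "{v, a, b} = {v, a', b'}" and "a \<in> N" "b \<in> N'" "a' \<in> N" "b' \<in> N'"
          using xy eq by auto
        then have "a = a'" "b = b'" using recover by (metis singleton_inject)+
        then show "x = y" using x y by simp
      qed
      show "(\<lambda>(a, b). {v, a, b}) ` (N \<times> N') = {T \<in> Tr. mixed T v}"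
      proof (intro equalityI subsetI)
        fix T assume "T \<in> (\<lambda>(a, b). {v, a, b}) ` (N \<times> N')"
        then obtain a b where ab: "a \<in> N" "b \<in> N'" "T = {v, a, b}" by auto
        then have "a \<noteq> v" "b \<noteq> v" "a \<noteq> b" "a \<in> pverts G" "b \<in> pverts G" using N N' by auto
        then show "T \<in> {T \<in> Tr. mixed T v}"
          using ab v by (auto simp: Tr_def mixed_def N_def N'_def)
      next
        fix T assume "T \<in> {T \<in> Tr. mixed T v}"
        then obtain a b where T: "T \<in> Tr" "v \<in> T" and ab: "a \<in> T" "?E v a" "b \<in> T" "b \<noteq> v" "\<not> ?E v b"
          by (auto simp: mixed_def)
        have "a \<noteq> v" "a \<noteq> b" using ab irrefl by auto
        then have "card {v, a, b} = 3" using ab by auto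
        then have "{v, a, b} = T"
          using T ab by (intro card_subset_eq) (auto simp: Tr_def intro: card_ge_0_finite)
        moreover have "a \<in> N" "b \<in> N'" using ab T by (auto simp: N_def N'_def Tr_def)
        ultimately show "T \<in> (\<lambda>(a, b). {v, a, b}) ` (N \<times> N')" by (intro image_eqI[of _ _ "(a, b)"]) auto
      qed
    qed
    from bij_betw_same_card[OF this] have "card {T \<in> Tr. mixed T v} = card N * card N'"
      by (simp add: card_cartesian_product)
    then show ?thesis using deg card_N' by simp
  qed
  define U where "U = triangles G \<union> anti_triangles G"
  \<comment> \<open>Double counting of the pairs of a triple and a vertex at which it is
    mixed.\<close>
  have "(\<Sum>v\<in>pverts G. degree G v * (n - 1 - degree G v)) = (\<Sum>T\<in>Tr. if T \<in> U then 0 else 2)"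
    unfolding U_def
    using sum_multicount_gen[of "pverts G" Tr "\<lambda>v T. mixed T v"] finV finTr count pairs by simp
  also have "\<dots> = 2 * card (Tr - U)"
    using finTr by (simp add: sum.If_cases Diff_eq)
  finally have "(\<Sum>v\<in>pverts G. degree G v * (n - 1 - degree G v)) =
    2 * (card Tr - (card (triangles G) + card (anti_triangles G)))"
    using sub fin_un by (simp add: U_def card_Diff_subset card_un)
  \<comment> \<open>This bound keeps the subtraction above from being truncated.\<close>
  moreover have "card (triangles G) + card (anti_triangles G) \<le> card Tr"
    using card_mono[OF finTr, of "triangles G \<union> anti_triangles G"] sub card_un by simp
  moreover have "card Tr = n choose 3"
    using n_subsets[OF finV] by (simp add: Tr_def n_def)
  ultimately show ?thesis by simp
qed

section \<open>The graph on 27 vertices\<close>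

lemma choose_27_3: "(27 :: nat) choose 3 = 2925"
  using binomial_fact_lemma[of 3 27] by (simp add: fact_numeral)

text \<open>A vertex of degree 14 contributes 14 * 12 to Goodman's sum, one less than 13 * 13. Three
  of them give 27 * 169 - 3 = 4560 and thus 645 triples; a single one would give 644.\<close>

lemma near_minimal_graph_27:
  "\<exists>G :: nat pair_pre_digraph.
    pair_graph G \<and> card (pverts G) = 27 \<and> \<not> has_induced_cycle 5 G \<and>
    card (triangles G) + card (anti_triangles G) = 645"
proof -
  \<comment> \<open>The antidiagonal classes 2, 4 and 6 are cliques of size 4, class 0 is an edge,
    and the remaining classes are independent. Class 8 carries the three vertices of degree
    14.\<close>
  define w :: "nat \<Rightarrow> nat" where "w = (!) [2, 2, 4, 2, 4, 3, 4, 3, 3]"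
  define e :: "nat \<Rightarrow> nat" where "e = (!) [1, 0, 0, 0, 0, 0, 0, 0, 0]"
  define c where "c = (!) [False, False, True, False, True, False, True, False, False]"
  let ?G = "blow_up w c e" and ?d = "\<lambda>p::nat. if p = 8 then 14 else 13 :: nat"
  have G: "pair_graph ?G" by (rule pair_graph_blow_up)
  have card: "card (pverts ?G) = 27"
    unfolding card_blow_up by (simp add: sum_less_9 w_def)
  have params: "\<forall>p<9. e p \<le> w p div 2 \<and> (odd (w p) \<longrightarrow> e p = 0) \<and>
      rook_weight w p + (if c p then w p - 1 - e p else e p) = ?d p"
    by (simp add: rook_simps w_def c_def e_def)
  have deg: "degree ?G v = ?d (v mod 9)" if v: "v \<in> pverts ?G" for v
    using degree_blow_up_typical[OF v refl] params[rule_format, of "v mod 9"] by simp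
  have "(\<Sum>v\<in>pverts ?G. degree ?G v * (27 - 1 - degree ?G v)) =
      (\<Sum>v | v div 9 < w (v mod 9). ?d (v mod 9) * (27 - 1 - ?d (v mod 9)))"
    by (rule sum.cong) (use deg in \<open>auto simp: blow_up_def\<close>)
  also have "\<dots> = (\<Sum>p<9. \<Sum>x<w p. ?d p * (27 - 1 - ?d p))"
    unfolding sum_blow_up by (intro sum.cong) auto
  also have "\<dots> = 4560"
    by (simp add: sum_less_9 w_def)
  finally have "2 * (27 choose 3) = 2 * (card (triangles ?G) + card (anti_triangles ?G)) + 4560"
    using goodman[OF G] card by simp
  then have "2 * 2925 = 2 * (card (triangles ?G) + card (anti_triangles ?G)) + 4560"
    by (simp only: choose_27_3)
  moreover have "t = 645" if "2 * 2925 = 2 * t + (4560 :: nat)" for t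
    using that by simp
  ultimately have "card (triangles ?G) + card (anti_triangles ?G) = 645" by blast
  then show ?thesis using G card no_induced_5_cycle_blow_up by blast
qed

section \<open>Covering all odd orders\<close>

lemma balanced_graph_exists:
  assumes "odd n" "17 \<le> n" "n \<noteq> 27"
  shows "balanced_graph_exists n"
proof -
  \<comment> \<open>The residues 1 and 9 modulo 16 come from \<open>8 * a + 1\<close>, the other six
    odd residues from one family each. For residue 11 the family starts at 43, right after the
    excluded 27.\<close>
  have "n = 19 \<or> n = 21 \<or> n = 23 \<or> n = 29 \<or> n = 45 \<or> (\<exists>a. n = 8 * a + 1 \<and> 0 < a) \<or>
    (\<exists>a. n = 16 * a + 31) \<or> (\<exists>a. n = 16 * a + 35) \<or> (\<exists>a. n = 16 * a + 37) \<or>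
    (\<exists>a. n = 16 * a + 39) \<or> (\<exists>a. n = 16 * a + 43) \<or> (\<exists>a. n = 16 * a + 61)"
    using assms by presburger
  then show ?thesis
    using balanced_8a_plus_1 balanced_19 balanced_21 balanced_23 balanced_29 balanced_45
      balanced_16a_plus_31 balanced_16a_plus_35 balanced_16a_plus_37 balanced_16a_plus_39
      balanced_16a_plus_43 balanced_16a_plus_61
    by blast
qed

theorem theorem3:
  shows
    "(\<forall>n::nat. odd n \<and> n \<ge> 17 \<and> n \<noteq> 27 \<longrightarrow>
        (\<exists>G :: nat pair_pre_digraph.
          pair_graph G \<and> card (pverts G) = n \<and> \<not> has_induced_cycle 5 G \<and>
          (n mod 4 = 1 \<longrightarrow> regular ((n - 1) div 2) G) \<and>
          (n mod 4 = 3 \<longrightarrow> almost_regular ((n - 1) div 2) G))) \<and>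
     (\<exists>G :: nat pair_pre_digraph.
        pair_graph G \<and> card (pverts G) = 27 \<and> \<not> has_induced_cycle 5 G \<and>
        real (card (triangles G) + card (anti_triangles G)) = M 27 + 1 \<and>
        M 27 + 1 = 645)"
proof (intro conjI allI impI)
  fix n :: nat
  assume "odd n \<and> n \<ge> 17 \<and> n \<noteq> 27"
  then have "balanced_graph_exists n"
    using balanced_graph_exists by blast
  then show "\<exists>G :: nat pair_pre_digraph.
      pair_graph G \<and> card (pverts G) = n \<and> \<not> has_induced_cycle 5 G \<and>
      (n mod 4 = 1 \<longrightarrow> regular ((n - 1) div 2) G) \<and>
      (n mod 4 = 3 \<longrightarrow> almost_regular ((n - 1) div 2) G)"
    unfolding balanced_graph_exists_def .
next
  obtain G :: "nat pair_pre_digraph" where G: "pair_graph G" "card (pverts G) = 27"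
    "\<not> has_induced_cycle 5 G" and count: "card (triangles G) + card (anti_triangles G) = 645"
    using near_minimal_graph_27 by blast
  have "real (card (triangles G) + card (anti_triangles G)) = M 27 + 1"
    unfolding count M_27 by simp
  moreover have "M 27 + 1 = 645"
    unfolding M_27 by simp
  ultimately show "\<exists>G :: nat pair_pre_digraph.
      pair_graph G \<and> card (pverts G) = 27 \<and> \<not> has_induced_cycle 5 G \<and>
      real (card (triangles G) + card (anti_triangles G)) = M 27 + 1 \<and> M 27 + 1 = 645"
    using G by blast
qed

end
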